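(* Let $\Psi=(\Psi_1,\Psi_2)$ and $\Phi=(\Phi_1,\Phi_2)$ be smooth complex-valued functions of $(z,\tau)$, $z\in U\subset\mathbb{C}$ open, $\tau$ in an interval, and let $x^1,x^2,x^3,x^4$ be smooth real-valued functions of $(z,\tau)$ satisfying, for every $\tau$, $$\partial_z x^1=\tfrac{i}{2}(\bar\Phi_2\bar\Psi_2+\Phi_1\Psi_1),\quad \partial_z x^2=\tfrac12(\bar\Phi_2\bar\Psi_2-\Phi_1\Psi_1),$$ $$\partial_z x^3=\tfrac12(\bar\Phi_2\Psi_1+\Phi_1\bar\Psi_2),\quad \partial_z x^4=\tfrac{i}{2}(\bar\Phi_2\Psi_1-\Phi_1\bar\Psi_2).$$ Suppose that $$\partial_\tau\Psi_1=(x^3-ix^4)\Psi_1-i(x^1-ix^2)\bar\Psi_2,\qquad \partial_\tau\Psi_2=(x^3-ix^4)\Psi_2+i(x^1-ix^2)\bar\Psi_1,$$ $$\partial_\tau\Phi_1=(x^3+ix^4)\Phi_1-i(x^1-ix^2)\bar\Phi_2,\qquad \partial_\tau\Phi_2=(x^3+ix^4)\Phi_2+i(x^1-ix^2)\bar\Phi_1.$$ Then for $k=1,\dots,4$, $$\partial_\tau\partial_z x^k=\partial_z\big(V^k(x)\big),$$ where $V=(V^1,V^2,V^3,V^4)$ is the vector field on $\mathbb{R}^4$ $$V^1=2x^1x^3,\quad V^2=2x^2x^3,\quad V^3=(x^3)^2-(x^1)^2-(x^2)^2-(x^4)^2,\quad V^4=2x^4x^3,$$ which is the generator of a one-parameter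 group of conformal transformations of $\mathbb{R}^4\cup\{\infty\}$ (conjugate to an inversion). Consequently, with a suitable choice of integration constants, $\partial_\tau x^k=V^k(x)$, i.e. the flow on $(\Psi,\Phi)$ induces this infinitesimal conformal transformation of the surface $z\mapsto(x^1,\dots,x^4)$.
   Context: $\partial_z=\frac12(\partial_x-i\partial_y)$ for $z=x+iy$; bars denote complex conjugation. The displayed formulas for $\partial_z x^k$ are the Weierstrass representation of a surface in $\mathbb{R}^4$ in terms of spinors $\Psi,\Phi$. *)

theory Defs
  imports "HOL-Analysis.Analysis"
begin

definition dirderiv :: "'a::real_normed_vector \<Rightarrow> ('a \<Rightarrow> 'b::real_normed_vector) \<Rightarrow> 'a \<Rightarrow> 'b" where
  "dirderiv v f p = vector_derivative (\<lambda>s. f (p + s *\<^sub>R v)) (at 0)"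

fun iter_pd :: "'a::real_normed_vector list \<Rightarrow> ('a \<Rightarrow> 'b::real_normed_vector) \<Rightarrow> 'a \<Rightarrow> 'b" where
  "iter_pd [] f = f"
| "iter_pd (v # vs) f = dirderiv v (iter_pd vs f)"

definition smooth_on :: "'a::euclidean_space set \<Rightarrow> ('a \<Rightarrow> 'b::real_normed_vector) \<Rightarrow> bool" where
  "smooth_on S f \<longleftrightarrow>
     (\<forall>vs. set vs \<subseteq> Basis \<longrightarrow>
        continuous_on S (iter_pd vs f) \<and>
        (\<forall>v\<in>Basis. \<forall>p\<in>S. (\<lambda>s. iter_pd vs f (p + s *\<^sub>R v)) differentiable (at 0)))"

text \<open>Partial derivatives on complex x real, with z = x + i y.\<close>

definition d_tau :: "(complex \<times> real \<Rightarrow> 'b::real_normed_vector) \<Rightarrow> complex \<times> real \<Rightarrow> 'b" where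
  "d_tau f = dirderiv (0, 1) f"

definition d_z :: "(complex \<times> real \<Rightarrow> complex) \<Rightarrow> complex \<times> real \<Rightarrow> complex" where
  "d_z f p = (dirderiv (1, 0) f p - \<i> * dirderiv (\<i>, 0) f p) / 2"

definition V1 :: "real \<Rightarrow> real \<Rightarrow> real \<Rightarrow> real \<Rightarrow> real" where
  "V1 a b c d = 2 * a * c"
definition V2 :: "real \<Rightarrow> real \<Rightarrow> real \<Rightarrow> real \<Rightarrow> real" where
  "V2 a b c d = 2 * b * c"
definition V3 :: "real \<Rightarrow> real \<Rightarrow> real \<Rightarrow> real \<Rightarrow> real" where
  "V3 a b c d = c^2 - a^2 - b^2 - d^2"
definition V4 :: "real \<Rightarrow> real \<Rightarrow> real \<Rightarrow> real \<Rightarrow> real" where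
  "V4 a b c d = 2 * d * c"

end

theory Submission
  imports Defs
begin

text \<open>Differentiating the Weierstrass formulas for \<open>\<partial>\<^sub>z x\<^sup>k\<close> in \<open>\<tau>\<close> by the Leibniz rule
  and inserting the flow equations for \<open>\<Psi>, \<Phi>\<close> gives an expression bilinear in the spinors
  with coefficients linear in \<open>x\<close>. Regrouped by the Weierstrass formulas it becomes
  \<open>\<Sum>\<^sub>j (\<partial>V\<^sup>k/\<partial>x\<^sup>j) \<partial>\<^sub>z x\<^sup>j\<close>, which is \<open>\<partial>\<^sub>z (V\<^sup>k \<circ> x)\<close> by the chain rule. The
  \<open>\<tau>\<close>-derivative may be taken through the Weierstrass formulas because they hold on the
  whole open set \<open>U \<times> I\<close>.\<close>

definition has_z_partials :: "(complex \<times> real \<Rightarrow> 'b::real_normed_vector) \<Rightarrow> complex \<times> real \<Rightarrow> bool" where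
  "has_z_partials f p \<longleftrightarrow>
     (\<lambda>s. f (p + s *\<^sub>R (1, 0))) differentiable at 0 \<and> (\<lambda>s. f (p + s *\<^sub>R (\<i>, 0))) differentiable at 0"

lemma smooth_on_differentiable_along:
  assumes "smooth_on S f" "v \<in> Basis" "p \<in> S"
  shows "(\<lambda>s. f (p + s *\<^sub>R v)) differentiable at 0"
  using assms unfolding smooth_on_def by (metis empty_subsetI iter_pd.simps(1) list.set(1))

lemma smooth_on_has_z_partials:
  fixes S :: "(complex \<times> real) set"
  shows "smooth_on S f \<Longrightarrow> p \<in> S \<Longrightarrow> has_z_partials f p"
  unfolding has_z_partials_def
  by (intro conjI smooth_on_differentiable_along) (auto simp: Basis_prod_def Basis_complex_def)

lemma dirderiv_cong_open:
  assumes "open S" "p \<in> S" "\<And>q. q \<in> S \<Longrightarrow> f q = g q"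
  shows "dirderiv v f p = dirderiv v g p"
proof -
  have "open {s::real. p + s *\<^sub>R v \<in> S}"
    using assms(1) by (intro continuous_open_vimage[unfolded vimage_def] allI continuous_intros)
  from eventually_nhds_in_open[OF this, of 0]
  have "eventually (\<lambda>s. p + s *\<^sub>R v \<in> S) (nhds 0)"
    using assms(2) by simp
  then have "eventually (\<lambda>s. f (p + s *\<^sub>R v) = g (p + s *\<^sub>R v)) (nhds 0)"
    by eventually_elim (use assms(3) in blast)
  then show ?thesis
    unfolding dirderiv_def by (intro vector_derivative_cong_eq) (auto elim: eventually_mono)
qed

lemma dirderiv_const: "dirderiv v (\<lambda>q. c) p = 0"
  by (simp add: dirderiv_def)

lemma dirderiv_add:
  assumes "(\<lambda>s. f (p + s *\<^sub>R v)) differentiable at 0" "(\<lambda>s. g (p + s *\<^sub>R v)) differentiable at 0"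
  shows "dirderiv v (\<lambda>q. f q + g q) p = dirderiv v f p + dirderiv v g p"
  using assms by (simp add: dirderiv_def)

lemma dirderiv_diff:
  assumes "(\<lambda>s. f (p + s *\<^sub>R v)) differentiable at 0" "(\<lambda>s. g (p + s *\<^sub>R v)) differentiable at 0"
  shows "dirderiv v (\<lambda>q. f q - g q) p = dirderiv v f p - dirderiv v g p"
  using assms by (simp add: dirderiv_def)

lemma dirderiv_mult:
  fixes f g :: "'a::real_normed_vector \<Rightarrow> 'b::real_normed_algebra"
  assumes "(\<lambda>s. f (p + s *\<^sub>R v)) differentiable at 0" "(\<lambda>s. g (p + s *\<^sub>R v)) differentiable at 0"
  shows "dirderiv v (\<lambda>q. f q * g q) p = f p * dirderiv v g p + dirderiv v f p * g p"
  using assms by (simp add: dirderiv_def)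

lemma dirderiv_cnj:
  assumes "(\<lambda>s. f (p + s *\<^sub>R v)) differentiable at 0"
  shows "dirderiv v (\<lambda>q. cnj (f q)) p = cnj (dirderiv v f p)"
  using assms by (simp add: dirderiv_def vector_derivative_cnj)

lemma dirderiv_of_real:
  fixes f :: "'a::real_normed_vector \<Rightarrow> real"
  assumes "(\<lambda>s. f (p + s *\<^sub>R v)) differentiable at 0"
  shows "dirderiv v (\<lambda>q. of_real (f q) :: 'b::real_normed_algebra_1) p = of_real (dirderiv v f p)"
  using assms unfolding dirderiv_def
  by (intro vector_derivative_at has_vector_derivative_of_real)
     (simp add: has_real_derivative_iff_has_vector_derivative vector_derivative_works)

lemma d_z_of_real:
  fixes f :: "complex \<times> real \<Rightarrow> real"
  assumes "has_z_partials f p"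
  shows "d_z (\<lambda>q. of_real (f q)) p
           = (of_real (dirderiv (1, 0) f p) - \<i> * of_real (dirderiv (\<i>, 0) f p)) / 2"
  using assms by (simp add: has_z_partials_def d_z_def dirderiv_of_real)

lemma d_z_V_chain_rule:
  fixes x1 x2 x3 x4 :: "complex \<times> real \<Rightarrow> real"
  assumes "has_z_partials x1 p" "has_z_partials x2 p" "has_z_partials x3 p" "has_z_partials x4 p"
  shows "d_z (\<lambda>q. of_real (V1 (x1 q) (x2 q) (x3 q) (x4 q))) p
           = 2 * (of_real (x1 p) * d_z (\<lambda>q. of_real (x3 q)) p + of_real (x3 p) * d_z (\<lambda>q. of_real (x1 q)) p)"
    and "d_z (\<lambda>q. of_real (V2 (x1 q) (x2 q) (x3 q) (x4 q))) p
           = 2 * (of_real (x2 p) * d_z (\<lambda>q. of_real (x3 q)) p + of_real (x3 p) * d_z (\<lambda>q. of_real (x2 q)) p)"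
    and "d_z (\<lambda>q. of_real (V3 (x1 q) (x2 q) (x3 q) (x4 q))) p
           = 2 * (of_real (x3 p) * d_z (\<lambda>q. of_real (x3 q)) p - of_real (x1 p) * d_z (\<lambda>q. of_real (x1 q)) p
                  - of_real (x2 p) * d_z (\<lambda>q. of_real (x2 q)) p - of_real (x4 p) * d_z (\<lambda>q. of_real (x4 q)) p)"
    and "d_z (\<lambda>q. of_real (V4 (x1 q) (x2 q) (x3 q) (x4 q))) p
           = 2 * (of_real (x4 p) * d_z (\<lambda>q. of_real (x3 q)) p + of_real (x3 p) * d_z (\<lambda>q. of_real (x4 q)) p)"
  using assms
  by (subst d_z_of_real,
      simp add: has_z_partials_def V1_def V2_def V3_def V4_def power2_eq_square,
      simp add: d_z_of_real has_z_partials_def dirderiv_def V1_def V2_def V3_def V4_def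
        power2_eq_square field_simps flip: zero_prod_def)+

theorem theorem3:
  fixes U :: "complex set" and I :: "real set"
    and Psi1 Psi2 Phi1 Phi2 :: "complex \<times> real \<Rightarrow> complex"
    and x1 x2 x3 x4 :: "complex \<times> real \<Rightarrow> real"
  assumes U: "open U" and I: "open I" "is_interval I"
    and sm: "smooth_on (U \<times> I) Psi1" "smooth_on (U \<times> I) Psi2"
            "smooth_on (U \<times> I) Phi1" "smooth_on (U \<times> I) Phi2"
            "smooth_on (U \<times> I) x1" "smooth_on (U \<times> I) x2"
            "smooth_on (U \<times> I) x3" "smooth_on (U \<times> I) x4"
    and W1: "\<And>p. p \<in> U \<times> I \<Longrightarrow> d_z (\<lambda>q. of_real (x1 q)) p
              = \<i>/2 * (cnj (Phi2 p) * cnj (Psi2 p) + Phi1 p * Psi1 p)"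
    and W2: "\<And>p. p \<in> U \<times> I \<Longrightarrow> d_z (\<lambda>q. of_real (x2 q)) p
              = 1/2 * (cnj (Phi2 p) * cnj (Psi2 p) - Phi1 p * Psi1 p)"
    and W3: "\<And>p. p \<in> U \<times> I \<Longrightarrow> d_z (\<lambda>q. of_real (x3 q)) p
              = 1/2 * (cnj (Phi2 p) * Psi1 p + Phi1 p * cnj (Psi2 p))"
    and W4: "\<And>p. p \<in> U \<times> I \<Longrightarrow> d_z (\<lambda>q. of_real (x4 q)) p
              = \<i>/2 * (cnj (Phi2 p) * Psi1 p - Phi1 p * cnj (Psi2 p))"
    and E1: "\<And>p. p \<in> U \<times> I \<Longrightarrow> d_tau Psi1 p
              = (of_real (x3 p) - \<i> * of_real (x4 p)) * Psi1 p
                - \<i> * (of_real (x1 p) - \<i> * of_real (x2 p)) * cnj (Psi2 p)"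
    and E2: "\<And>p. p \<in> U \<times> I \<Longrightarrow> d_tau Psi2 p
              = (of_real (x3 p) - \<i> * of_real (x4 p)) * Psi2 p
                + \<i> * (of_real (x1 p) - \<i> * of_real (x2 p)) * cnj (Psi1 p)"
    and E3: "\<And>p. p \<in> U \<times> I \<Longrightarrow> d_tau Phi1 p
              = (of_real (x3 p) + \<i> * of_real (x4 p)) * Phi1 p
                - \<i> * (of_real (x1 p) - \<i> * of_real (x2 p)) * cnj (Phi2 p)"
    and E4: "\<And>p. p \<in> U \<times> I \<Longrightarrow> d_tau Phi2 p
              = (of_real (x3 p) + \<i> * of_real (x4 p)) * Phi2 p
                + \<i> * (of_real (x1 p) - \<i> * of_real (x2 p)) * cnj (Phi1 p)"
  shows "\<forall>p \<in> U \<times> I.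
           d_tau (d_z (\<lambda>q. of_real (x1 q))) p
             = d_z (\<lambda>q. of_real (V1 (x1 q) (x2 q) (x3 q) (x4 q))) p
         \<and> d_tau (d_z (\<lambda>q. of_real (x2 q))) p
             = d_z (\<lambda>q. of_real (V2 (x1 q) (x2 q) (x3 q) (x4 q))) p
         \<and> d_tau (d_z (\<lambda>q. of_real (x3 q))) p
             = d_z (\<lambda>q. of_real (V3 (x1 q) (x2 q) (x3 q) (x4 q))) p
         \<and> d_tau (d_z (\<lambda>q. of_real (x4 q))) p
             = d_z (\<lambda>q. of_real (V4 (x1 q) (x2 q) (x3 q) (x4 q))) p"
proof (intro ballI)
  fix p assume p: "p \<in> U \<times> I"
  have UI: "open (U \<times> I)"
    using U I(1) by (rule open_Times)
  have tau_differentiable: "(\<lambda>s. F (p + s *\<^sub>R (0, 1))) differentiable at 0"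
    if "smooth_on (U \<times> I) F" for F :: "complex \<times> real \<Rightarrow> complex"
    by (rule smooth_on_differentiable_along[OF that _ p]) (simp add: Basis_prod_def)
  have z_partials: "has_z_partials x1 p" "has_z_partials x2 p" "has_z_partials x3 p" "has_z_partials x4 p"
    using sm(5-8) p by (auto intro: smooth_on_has_z_partials)
  have d_tau_d_z:
    "d_tau (d_z (\<lambda>q. of_real (x1 q))) p
       = d_tau (\<lambda>q. \<i>/2 * (cnj (Phi2 q) * cnj (Psi2 q) + Phi1 q * Psi1 q)) p"
    "d_tau (d_z (\<lambda>q. of_real (x2 q))) p
       = d_tau (\<lambda>q. 1/2 * (cnj (Phi2 q) * cnj (Psi2 q) - Phi1 q * Psi1 q)) p"
    "d_tau (d_z (\<lambda>q. of_real (x3 q))) p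
       = d_tau (\<lambda>q. 1/2 * (cnj (Phi2 q) * Psi1 q + Phi1 q * cnj (Psi2 q))) p"
    "d_tau (d_z (\<lambda>q. of_real (x4 q))) p
       = d_tau (\<lambda>q. \<i>/2 * (cnj (Phi2 q) * Psi1 q - Phi1 q * cnj (Psi2 q))) p"
    unfolding d_tau_def using UI p W1 W2 W3 W4 by (blast intro: dirderiv_cong_open)+
  show "d_tau (d_z (\<lambda>q. of_real (x1 q))) p
          = d_z (\<lambda>q. of_real (V1 (x1 q) (x2 q) (x3 q) (x4 q))) p
      \<and> d_tau (d_z (\<lambda>q. of_real (x2 q))) p
          = d_z (\<lambda>q. of_real (V2 (x1 q) (x2 q) (x3 q) (x4 q))) p
      \<and> d_tau (d_z (\<lambda>q. of_real (x3 q))) p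
          = d_z (\<lambda>q. of_real (V3 (x1 q) (x2 q) (x3 q) (x4 q))) p
      \<and> d_tau (d_z (\<lambda>q. of_real (x4 q))) p
          = d_z (\<lambda>q. of_real (V4 (x1 q) (x2 q) (x3 q) (x4 q))) p"
    unfolding d_tau_d_z d_z_V_chain_rule[OF z_partials] W1[OF p] W2[OF p] W3[OF p] W4[OF p]
    unfolding d_tau_def
    using tau_differentiable[OF sm(1)] tau_differentiable[OF sm(2)]
      tau_differentiable[OF sm(3)] tau_differentiable[OF sm(4)]
    by (simp only: dirderiv_const dirderiv_add dirderiv_diff dirderiv_mult dirderiv_cnj
          differentiable_const differentiable_add differentiable_diff differentiable_mult differentiable_cnj_iff)
      (simp add: E1[OF p, unfolded d_tau_def] E2[OF p, unfolded d_tau_def] E3[OF p, unfolded d_tau_def]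
          E4[OF p, unfolded d_tau_def] field_simps)
qed

end
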